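(* Let $L$ be a finite lower dismantlable lattice having $(0,1)$ as an adjunct pair. The following statements are equivalent. (a) $G_{\{0\}}(L)$ is a complete bipartite graph. (b) $L$ is an adjunct of two chains only. (c) $L$ has exactly two atoms and exactly two dual atoms. (d) There exist two minimal prime ideals $P_1,P_2$ of $L$ such that $P_1\cap P_2=\{0\}$. (e) $L$ is a $0$-distributive lattice.
   Context: Adjunct operation: for disjoint finite lattices $L_1,L_2$ and $a<b$ in $L_1$ with $b$ not covering $a$, $L_1]_a^bL_2$ is $L_1\cup L_2$ ordered by: $x\le y$ iff ($x,y\in L_1$, $x\le y$ in $L_1$) or ($x,y\in L_2$, $x\le y$ in $L_2$) or ($x\in L_1$, $y\in L_2$, $x\le a$) or ($x\in L_2$, $y\in L_1$, $b\le y$); $(a,b)$ is an adjunct pair. A finite lattice is dismantlable iff it is an adjunct of chains $C_0]_{a_1}^{b_1}C_1\cdots]_{a_n}^{b_n}C_n$; it is lower dismantlable if it is a chain or every adjunct pair in it is of the form $(0,b)$. Atoms are elements covering $0$; dual atoms are elements covered by $1$. An ideal is a nonempty down-closed subset closed under joins; a prime ideal is a proper ideal $P$ with $a\wedge b\in P\Rightarrow a\in P$ or $b\in P$; a minimal prime ideal is a prime ideal minimal under inclusion among prime ideals. $L$ is $0$-distributive if $a\wedge b=a\wedge c=0$ implies $a\wedge(b\vee c)=0$. The zero-divisor graph $G_{\{0\}}(L)$ has vertex set $\{x\in L\setminus\{0\}: x\wedge y=0\text{ for some }y\in L\setminus\{0\}\}$, distinct vertices $x,y$ adjacent iff $x\wedge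 y=0$. *)

theory Defs
  imports Main "Graph_Theory.Kuratowski"
begin

text \<open>
  A finite ordered set is represented by its reflexive order relation \<open>r\<close>, with underlying
  set \<open>Field r\<close>. The ambient lattice is a type of class \<open>{finite, bounded_lattice}\<close>.
\<close>

abbreviation ord_rel :: "'a::order rel" where
  "ord_rel \<equiv> relation_of (\<le>) UNIV"

definition covered_by :: "'a rel \<Rightarrow> 'a \<Rightarrow> 'a \<Rightarrow> bool" where
  "covered_by r a b \<longleftrightarrow> (a, b) \<in> r \<and> a \<noteq> b \<and>
     \<not> (\<exists>c. (a, c) \<in> r \<and> c \<noteq> a \<and> (c, b) \<in> r \<and> c \<noteq> b)"

definition fin_chain :: "'a rel \<Rightarrow> bool" where
  "fin_chain r \<longleftrightarrow> finite (Field r) \<and> Field r \<noteq> {} \<and> Linear_order r"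

definition adjunct :: "'a rel \<Rightarrow> 'a \<Rightarrow> 'a \<Rightarrow> 'a rel \<Rightarrow> 'a rel" where
  "adjunct r1 a b r2 = r1 \<union> r2
     \<union> {(x, y). x \<in> Field r1 \<and> y \<in> Field r2 \<and> (x, a) \<in> r1}
     \<union> {(x, y). x \<in> Field r2 \<and> y \<in> Field r1 \<and> (b, y) \<in> r1}"

definition adjunct_admissible :: "'a rel \<Rightarrow> 'a \<Rightarrow> 'a \<Rightarrow> 'a rel \<Rightarrow> bool" where
  "adjunct_admissible r1 a b r2 \<longleftrightarrow>
     Field r1 \<inter> Field r2 = {} \<and> (a, b) \<in> r1 \<and> a \<noteq> b \<and> \<not> covered_by r1 a b"

text \<open>
  \<open>adjunct_of_chains [C\<^sub>0, \<dots>, C\<^sub>n] [(a\<^sub>1, b\<^sub>1), \<dots>, (a\<^sub>n, b\<^sub>n)] r\<close> says that \<open>r\<close> is the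
  left-associated adjunct \<open>C\<^sub>0 ] C\<^sub>1 \<dots> ] C\<^sub>n\<close> formed at the pairs \<open>(a\<^sub>i, b\<^sub>i)\<close>.
\<close>

inductive adjunct_of_chains :: "'a rel list \<Rightarrow> ('a \<times> 'a) list \<Rightarrow> 'a rel \<Rightarrow> bool" where
  single: "fin_chain C \<Longrightarrow> adjunct_of_chains [C] [] C"
| adjoin: "adjunct_of_chains Cs ps r \<Longrightarrow> fin_chain C \<Longrightarrow> adjunct_admissible r a b C \<Longrightarrow>
     adjunct_of_chains (Cs @ [C]) (ps @ [(a, b)]) (adjunct r a b C)"

definition dismantlable :: "'a rel \<Rightarrow> bool" where
  "dismantlable r \<longleftrightarrow> (\<exists>Cs ps. adjunct_of_chains Cs ps r)"

definition adjunct_pair :: "'a rel \<Rightarrow> 'a \<Rightarrow> 'a \<Rightarrow> bool" where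
  "adjunct_pair r a b \<longleftrightarrow> (\<exists>Cs ps. adjunct_of_chains Cs ps r \<and> (a, b) \<in> set ps)"

definition least_in :: "'a rel \<Rightarrow> 'a \<Rightarrow> bool" where
  "least_in r z \<longleftrightarrow> z \<in> Field r \<and> (\<forall>x\<in>Field r. (z, x) \<in> r)"

definition lower_dismantlable :: "'a rel \<Rightarrow> bool" where
  "lower_dismantlable r \<longleftrightarrow> dismantlable r \<and>
     (fin_chain r \<or> (\<forall>a b. adjunct_pair r a b \<longrightarrow> least_in r a))"

definition atom :: "'a::{order, order_bot} \<Rightarrow> bool" where
  "atom x \<longleftrightarrow> covered_by ord_rel bot x"

definition dual_atom :: "'a::{order, order_top} \<Rightarrow> bool" where
  "dual_atom x \<longleftrightarrow> covered_by ord_rel x top"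

definition lattice_ideal :: "'a::lattice set \<Rightarrow> bool" where
  "lattice_ideal I \<longleftrightarrow> I \<noteq> {} \<and> (\<forall>x\<in>I. \<forall>y. y \<le> x \<longrightarrow> y \<in> I) \<and> (\<forall>x\<in>I. \<forall>y\<in>I. sup x y \<in> I)"

definition prime_lattice_ideal :: "'a::lattice set \<Rightarrow> bool" where
  "prime_lattice_ideal P \<longleftrightarrow> lattice_ideal P \<and> P \<noteq> UNIV \<and>
     (\<forall>a b. inf a b \<in> P \<longrightarrow> a \<in> P \<or> b \<in> P)"

definition minimal_prime_lattice_ideal :: "'a::lattice set \<Rightarrow> bool" where
  "minimal_prime_lattice_ideal P \<longleftrightarrow> prime_lattice_ideal P \<and>
     (\<forall>Q. prime_lattice_ideal Q \<longrightarrow> Q \<subseteq> P \<longrightarrow> Q = P)"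

definition zero_distributive :: "'a::bounded_lattice itself \<Rightarrow> bool" where
  "zero_distributive _ \<longleftrightarrow>
     (\<forall>a b c::'a. inf a b = bot \<longrightarrow> inf a c = bot \<longrightarrow> inf a (sup b c) = bot)"

definition zero_divisors :: "'a::bounded_lattice set" where
  "zero_divisors = {x. x \<noteq> bot \<and> (\<exists>y. y \<noteq> bot \<and> inf x y = bot)}"

text \<open>An undirected edge is a pair of opposite arcs.\<close>

definition zero_divisor_graph :: "'a::bounded_lattice pair_pre_digraph" where
  "zero_divisor_graph =
     \<lparr>pverts = zero_divisors,
      parcs = {(x, y). x \<in> zero_divisors \<and> y \<in> zero_divisors \<and> x \<noteq> y \<and> inf x y = bot}\<rparr>"

definition complete_bipartite :: "('a, 'b) pre_digraph \<Rightarrow> bool" where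
  "complete_bipartite G \<longleftrightarrow> (\<exists>m\<ge>1. \<exists>n\<ge>1. complete_bipartite_digraph m n G)"

end

theory Submission
  imports Defs
begin

text \<open>
  When every adjunct pair is of the form \<open>(0, b)\<close>, the elements above a fixed nonzero element form
  a chain: adjoining a chain at \<open>(0, b)\<close> puts nothing new above an old nonzero element, and above
  a new element lie only the rest of its chain and the elements above \<open>b\<close>. The pair \<open>(0, 1)\<close>
  therefore yields two atoms \<open>p\<close>, \<open>q\<close> with \<open>p \<squnion> q = 1\<close>. If there is no third atom, \<open>L\<close> consists of
  the two chains above \<open>p\<close> and \<open>q\<close>, glued at \<open>0\<close> and \<open>1\<close>, and all five statements can be read
  off. A third atom violates each of them: it gives a triangle in the zero-divisor graph, two of
  three atoms would lie in one of two chains, and it meets \<open>p\<close> and \<open>q\<close> in \<open>0\<close> but \<open>p \<squnion> q\<close> not.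
\<close>

section \<open>Atoms and dual atoms in terms of the order\<close>

lemma ord_rel_iff [simp]: "(x, y) \<in> ord_rel \<longleftrightarrow> x \<le> y"
  by (simp add: relation_of_def)

lemma Field_ord_rel [simp]: "Field (ord_rel :: 'a::order rel) = UNIV"
  by (auto simp: Field_def)

lemma atom_iff: "atom x \<longleftrightarrow> x \<noteq> bot \<and> (\<forall>y\<le>x. y = bot \<or> y = x)"
  for x :: "'a::{order, order_bot}"
  by (auto simp: atom_def covered_by_def)

lemma dual_atom_iff: "dual_atom x \<longleftrightarrow> x \<noteq> top \<and> (\<forall>y\<ge>x. y = top \<or> y = x)"
  for x :: "'a::{order, order_top}"
  by (auto simp: dual_atom_def covered_by_def)

lemma ex_atom_le:
  fixes x :: "'a::{finite, order, order_bot}"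
  assumes "x \<noteq> bot"
  obtains p where "atom p" "p \<le> x"
proof -
  have "x \<in> {y. y \<noteq> bot \<and> y \<le> x}" using assms by simp
  then obtain p where "p \<in> {y. y \<noteq> bot \<and> y \<le> x}"
    "\<forall>z\<in>{y. y \<noteq> bot \<and> y \<le> x}. z \<le> p \<longrightarrow> p = z"
    using finite_has_minimal[of "{y. y \<noteq> bot \<and> y \<le> x}"] by auto
  then have "atom p" "p \<le> x"
    by (auto simp: atom_iff intro: order_trans)
  then show thesis ..
qed

section \<open>Adjuncts of chains\<close>

lemma fin_chain_restrict:
  fixes S :: "'a::order set"
  assumes "finite S" "S \<noteq> {}" "\<And>x y. x \<in> S \<Longrightarrow> y \<in> S \<Longrightarrow> x \<le> y \<or> y \<le> x"
  shows "fin_chain (relation_of (\<le>) S)"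
proof -
  have F: "Field (relation_of (\<le>) S) = S"
    by (auto simp: relation_of_def Field_def)
  show ?thesis
    unfolding fin_chain_def F using assms
    by (auto simp: order_on_defs refl_on_def trans_def antisym_def total_on_def relation_of_def)
qed

lemma adjunct_mono: "r \<subseteq> adjunct r a b C"
  by (auto simp: adjunct_def)

text \<open>This recognises the order of a lattice as an adjunct: if bottom and top lie in
  \<open>S\<close>, the adjunct at \<open>(bot, top)\<close> adds only the comparabilities that hold
  in any bounded order, and \<open>ST\<close>, \<open>TS\<close> exclude all others between
  \<open>S\<close> and \<open>T\<close>.\<close>

lemma adjunct_bot_top_eq:
  fixes S T :: "'a::{order, order_bot, order_top} set"
  assumes "S \<union> T = UNIV" "S \<inter> T = {}" "bot \<in> S" "top \<in> S"
    and ST: "\<And>x y. x \<in> S \<Longrightarrow> y \<in> T \<Longrightarrow> x \<le> y \<Longrightarrow> x = bot"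
    and TS: "\<And>x y. x \<in> T \<Longrightarrow> y \<in> S \<Longrightarrow> x \<le> y \<Longrightarrow> y = top"
  shows "adjunct (relation_of (\<le>) S) bot top (relation_of (\<le>) T) = ord_rel"
proof (intro set_eqI, unfold split_paired_all)
  fix x y :: 'a
  have F: "Field (relation_of (\<le>) U) = U" for U :: "'a set"
    by (auto simp: relation_of_def Field_def)
  have T: "u \<in> T \<longleftrightarrow> u \<notin> S" for u using assms(1,2) by blast
  show "(x, y) \<in> adjunct (relation_of (\<le>) S) bot top (relation_of (\<le>) T) \<longleftrightarrow> (x, y) \<in> ord_rel"
    using ST[of x y] TS[of x y] assms(3,4) unfolding adjunct_def F T
    by (cases "x \<in> S"; cases "y \<in> S") (auto simp: relation_of_def T bot_unique top_unique)
qed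

text \<open>An old element gets new elements above it only if it is below \<open>a\<close>. For
  \<open>a = bot\<close> this leaves the up-sets of all old nonzero elements unchanged.\<close>

lemma adjunct_old:
  assumes "(x, y) \<in> adjunct r a b C" "x \<in> Field r" "(x, a) \<notin> r"
    "Field r \<inter> Field C = {}"
  shows "(x, y) \<in> r"
  using assms by (auto simp: adjunct_def Field_def)

lemma adjunct_new:
  assumes "(x, y) \<in> adjunct r a b C" "x \<in> Field C" "Field r \<inter> Field C = {}"
  shows "(x, y) \<in> C \<or> (b, y) \<in> r"
  using assms by (auto simp: adjunct_def Field_def)

lemma adjunct_new_le:
  assumes "x \<in> Field C" "(b, y) \<in> r"
  shows "(x, y) \<in> adjunct r a b C"
  using assms by (auto simp: adjunct_def Field_def)

text \<open>Since \<open>b\<close> does not cover \<open>a\<close>, some \<open>c\<close> lies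
  strictly between them in \<open>r\<close>, and \<open>c\<close> is incomparable to every element
  of the adjoined chain: \<open>c\<close> is not below \<open>a\<close>, and \<open>b\<close> is not
  below \<open>c\<close>.\<close>

lemma adjunct_not_linear:
  assumes adm: "adjunct_admissible r a b C" and "Field C \<noteq> {}"
  shows "\<not> Linear_order (adjunct r a b C)"
proof
  let ?s = "adjunct r a b C"
  assume lin: "Linear_order ?s"
  have disj: "Field r \<inter> Field C = {}"
    using adm by (simp add: adjunct_admissible_def)
  obtain x where x: "x \<in> Field C" using assms(2) by blast
  obtain c where c: "(a, c) \<in> r" "c \<noteq> a" "(c, b) \<in> r" "c \<noteq> b"
    using adm by (auto simp: adjunct_admissible_def covered_by_def)
  have cr: "c \<in> Field r" using c by (auto simp: Field_def)
  have anti: "u = v" if "(u, v) \<in> r" "(v, u) \<in> r" for u v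
    using lin that adjunct_mono[of r a b C]
    unfolding order_on_defs antisym_def by blast
  have "c \<in> Field ?s" "x \<in> Field ?s" "c \<noteq> x"
    using x cr disj by (auto simp: adjunct_def Field_def)
  then have "(c, x) \<in> ?s \<or> (x, c) \<in> ?s"
    using lin by (auto simp: order_on_defs total_on_def)
  then show False
  proof
    assume cx: "(c, x) \<in> ?s"
    have "(c, a) \<notin> r" using anti c by blast
    then have "(c, x) \<in> r" using adjunct_old[OF cx cr _ disj] by blast
    then show False using x disj by (auto simp: Field_def)
  next
    assume "(x, c) \<in> ?s"
    then have "(x, c) \<in> C \<or> (b, c) \<in> r" using adjunct_new x disj by metis
    then show False using anti c cr disj by (auto simp: Field_def)
  qed
qed

lemma adjunct_of_chains_linear:
  assumes "adjunct_of_chains Cs ps r" "Linear_order r"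
  shows "ps = []"
  using assms(1)
proof cases
  case single
  then show ?thesis by simp
next
  case (adjoin Cs' ps' r' C a b)
  then show ?thesis
    using adjunct_not_linear[of r' a b C] assms(2) by (simp add: fin_chain_def)
qed

text \<open>Induction on the adjunct. Above an old nonzero element nothing changes; what lies above
  a new element is a piece of the new chain followed by elements above \<open>b\<close>, where
  \<open>b\<close> is itself old and nonzero.\<close>

lemma adjunct_of_chains_up_chain:
  fixes r :: "'a::{order, order_bot} rel"
  assumes "adjunct_of_chains Cs ps r" "r \<subseteq> ord_rel" "fst ` set ps \<subseteq> {bot}"
    "x \<noteq> bot" "(x, y) \<in> r" "(x, z) \<in> r"
  shows "(y, z) \<in> r \<or> (z, y) \<in> r"
  using assms
proof (induction arbitrary: x y z rule: adjunct_of_chains.induct)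
  case (single C)
  have "y \<in> Field C" "z \<in> Field C"
    using single.prems by (auto simp: Field_def)
  then show ?case
    using single.hyps unfolding fin_chain_def order_on_defs total_on_def refl_on_def
    by (cases "y = z") auto
next
  case (adjoin Cs ps r C a b)
  have a: "a = bot" using adjoin.prems by auto
  have disj: "Field r \<inter> Field C = {}" and "a \<noteq> b"
    using adjoin.hyps by (auto simp: adjunct_admissible_def)
  have r: "r \<subseteq> ord_rel" using adjunct_mono adjoin.prems(1) by (rule order_trans)
  have nle: "(u, a) \<notin> r" if "u \<noteq> bot" for u
    using r that a by (auto simp: bot_unique)
  have IH: "(y, z) \<in> r \<or> (z, y) \<in> r" if "x \<noteq> bot" "(x, y) \<in> r" "(x, z) \<in> r" for x y z
    using adjoin.IH[OF r _ that] adjoin.prems by auto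
  have C: "(y, z) \<in> C \<or> (z, y) \<in> C" if "y \<in> Field C" "z \<in> Field C" for y z
    using adjoin.hyps that unfolding fin_chain_def order_on_defs total_on_def refl_on_def
    by (cases "y = z") auto
  have sub: "r \<subseteq> adjunct r a b C" "C \<subseteq> adjunct r a b C"
    by (auto simp: adjunct_def)
  have "x \<in> Field r \<or> x \<in> Field C"
    using adjoin.prems by (auto simp: adjunct_def Field_def)
  then show ?case
  proof
    assume x: "x \<in> Field r"
    have "(x, y) \<in> r" "(x, z) \<in> r"
      using adjunct_old[OF _ x nle disj] adjoin.prems by auto
    then show ?thesis using IH adjoin.prems sub by blast
  next
    assume x: "x \<in> Field C"
    have "(x, y) \<in> C \<or> (b, y) \<in> r" "(x, z) \<in> C \<or> (b, z) \<in> r"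
      using adjunct_new[OF _ x disj] adjoin.prems by auto
    moreover have "b \<noteq> bot" using a \<open>a \<noteq> b\<close> by blast
    \<comment> \<open>If \<open>y\<close> and \<open>z\<close> are both above \<open>b\<close>, the
      induction hypothesis at \<open>b\<close> compares them; if only one is, the other lies in
      \<open>C\<close> and hence below it by \<open>adjunct_new_le\<close>.\<close>
    ultimately show ?thesis
      using IH[of b y z] C[of y z] sub adjunct_new_le[of y C b z r a] adjunct_new_le[of z C b y r a]
      by (auto simp: Field_def)
  qed
qed

text \<open>The fork arises at the stage at which \<open>(bot, top)\<close> is adjoined. It survives
  all later stages, because they put nothing new above old nonzero elements.\<close>

lemma adjunct_of_chains_fork:
  fixes r :: "'a::{order, order_bot, order_top} rel"
  assumes "adjunct_of_chains Cs ps r" "r \<subseteq> ord_rel" "fst ` set ps \<subseteq> {bot}"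
    "(bot, top) \<in> set ps"
  shows "\<exists>x\<in>Field r. \<exists>y\<in>Field r. x \<noteq> bot \<and> x \<noteq> top \<and> y \<noteq> bot \<and> y \<noteq> top \<and>
    (\<forall>z. (x, z) \<in> r \<longrightarrow> (y, z) \<in> r \<longrightarrow> z = top)"
  using assms
proof (induction rule: adjunct_of_chains.induct)
  case (single C)
  then show ?case by simp
next
  case (adjoin Cs ps r C a b)
  have a: "a = bot" using adjoin.prems by auto
  have disj: "Field r \<inter> Field C = {}" and ab: "(a, b) \<in> r"
    using adjoin.hyps by (auto simp: adjunct_admissible_def)
  have r: "r \<subseteq> ord_rel" using adjunct_mono adjoin.prems(1) by (rule order_trans)
  have nle: "(u, a) \<notin> r" if "u \<noteq> bot" for u
    using r that a by (auto simp: bot_unique)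
  have F: "Field (adjunct r a b C) = Field r \<union> Field C"
    by (auto simp: adjunct_def Field_def)
  show ?case
  proof (cases "(bot, top) \<in> set ps")
    case True
    obtain x y where xy: "x \<in> Field r" "y \<in> Field r" "x \<noteq> bot" "x \<noteq> top" "y \<noteq> bot" "y \<noteq> top"
      and up: "\<And>z. (x, z) \<in> r \<Longrightarrow> (y, z) \<in> r \<Longrightarrow> z = top"
      using adjoin.IH[OF r _ True] adjoin.prems by auto
    have "z = top" if "(x, z) \<in> adjunct r a b C" "(y, z) \<in> adjunct r a b C" for z
      using that up adjunct_old nle xy disj by metis
    then show ?thesis using xy F by blast
  next
    case False
    then have b: "b = top" using adjoin.prems by auto
    \<comment> \<open>The witnesses are any element \<open>x\<close> of the new chain and a
      \<open>c\<close> strictly between \<open>a = bot\<close> and \<open>b = top\<close>.\<close>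
    obtain x where x: "x \<in> Field C" using adjoin.hyps by (auto simp: fin_chain_def)
    obtain c where c: "(a, c) \<in> r" "c \<noteq> a" "(c, b) \<in> r" "c \<noteq> b"
      using adjoin.hyps by (auto simp: adjunct_admissible_def covered_by_def)
    have cr: "c \<in> Field r" using c by (auto simp: Field_def)
    have "a \<in> Field r" "b \<in> Field r" using ab by (auto simp: Field_def)
    then have xne: "x \<noteq> bot" "x \<noteq> top" using x disj a b by auto
    have "z = top" if xz: "(x, z) \<in> adjunct r a b C" and cz: "(c, z) \<in> adjunct r a b C" for z
    proof -
      have "(c, z) \<in> r" using adjunct_old[OF cz cr _ disj] nle c a by blast
      then have "z \<in> Field r" by (auto simp: Field_def)
      \<comment> \<open>From the new element \<open>x\<close>, an old \<open>z\<close> is reached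
        only through \<open>b\<close>, which is the top.\<close>
      then have "(b, z) \<in> r" using adjunct_new[OF xz x disj] disj by (auto simp: Field_def)
      then show ?thesis using r b by (auto simp: top_unique)
    qed
    then show ?thesis using x xne cr c a b F by blast
  qed
qed

section \<open>Lattices in which nonzero elements have chains above them\<close>

text \<open>This keeps what the equivalences use of a lower dismantlable lattice with adjunct pair
  \<open>(0,1)\<close>, without reference to a decomposition into chains.\<close>

locale forked_lattice =
  fixes p q :: "'a::{finite, bounded_lattice}"
  assumes up_chain: "\<And>x y z :: 'a. x \<noteq> bot \<Longrightarrow> x \<le> y \<Longrightarrow> x \<le> z \<Longrightarrow> y \<le> z \<or> z \<le> y"
    and atoms: "atom p" "atom q" "p \<noteq> q"
    and sup_top: "sup p q = top"
begin

lemma atom_inf: "atom x \<Longrightarrow> atom y \<Longrightarrow> x \<noteq> y \<Longrightarrow> inf x y = bot" for x y :: 'a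
  by (metis atom_iff inf.cobounded1 inf.cobounded2)

lemma card_atoms_iff: "card {x :: 'a. atom x} = 2 \<longleftrightarrow> (\<forall>x :: 'a. atom x \<longrightarrow> x = p \<or> x = q)"
proof
  assume "card {x :: 'a. atom x} = 2"
  then obtain u v where "{x :: 'a. atom x} = {u, v}" by (auto simp: card_2_iff)
  then have "\<And>x :: 'a. atom x \<longleftrightarrow> x = u \<or> x = v" by blast
  then show "\<forall>x :: 'a. atom x \<longrightarrow> x = p \<or> x = q" using atoms by metis
next
  assume "\<forall>x :: 'a. atom x \<longrightarrow> x = p \<or> x = q"
  then have "{x :: 'a. atom x} = {p, q}" using atoms by auto
  then show "card {x :: 'a. atom x} = 2" using atoms by simp
qed

section \<open>Statements that exclude a third atom\<close>

lemma complete_bipartite_imp_atoms: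
  assumes "complete_bipartite (with_proj (zero_divisor_graph :: 'a pair_pre_digraph))"
    and x: "atom (x :: 'a)"
  shows "x = p \<or> x = q"
proof (rule ccontr)
  assume neg: "\<not> (x = p \<or> x = q)"
  obtain U V where UV: "U \<inter> V = {}"
    and E: "parcs (zero_divisor_graph :: 'a pair_pre_digraph) = U \<times> V \<union> V \<times> U"
    using assms(1) unfolding complete_bipartite_def complete_bipartite_digraph_pair_def by blast
  have arc: "(u, v) \<in> U \<times> V \<union> V \<times> U" if "atom u" "atom v" "u \<noteq> v" for u v
  proof -
    have "inf u v = bot" "inf v u = bot" "u \<noteq> bot" "v \<noteq> bot"
      using that atom_inf by (auto simp: atom_iff)
    then have "u \<in> zero_divisors" "v \<in> zero_divisors"
      unfolding zero_divisors_def by blast+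
    then show ?thesis
      unfolding E[symmetric] zero_divisor_graph_def
      using \<open>inf u v = bot\<close> \<open>u \<noteq> v\<close> by simp
  qed
  \<comment> \<open>Each arc joins the two disjoint sides, so a triangle on \<open>p\<close>,
    \<open>q\<close>, \<open>x\<close> would need three vertices on pairwise different
    sides.\<close>
  have "(p, q) \<in> U \<times> V \<union> V \<times> U" "(p, x) \<in> U \<times> V \<union> V \<times> U" "(q, x) \<in> U \<times> V \<union> V \<times> U"
    using arc atoms x neg by blast+
  then show False using UV by auto
qed

lemma two_chains_imp_atoms:
  assumes "adjunct_of_chains [C0, C1] [s] (ord_rel :: 'a rel)" and x: "atom (x :: 'a)"
  shows "x = p \<or> x = q"
proof -
  obtain C a b where C: "adjunct_of_chains [C0] [] C" "fin_chain C1"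
    and eq: "(ord_rel :: 'a rel) = adjunct C a b C1"
    using assms(1) by (cases rule: adjunct_of_chains.cases) auto
  have "fin_chain C" using C(1) by (cases rule: adjunct_of_chains.cases) auto
  have lin: "u \<le> v \<or> v \<le> u" if "fin_chain D" "D \<subseteq> ord_rel" "u \<in> Field D" "v \<in> Field D" for u v :: 'a and D
  proof (cases "u = v")
    case False
    then have "(u, v) \<in> D \<or> (v, u) \<in> D"
      using that by (auto simp: fin_chain_def order_on_defs total_on_def)
    then show ?thesis using that(2) by auto
  qed simp
  have sub: "C \<subseteq> ord_rel" "C1 \<subseteq> ord_rel" unfolding eq by (auto simp: adjunct_def)
  have "Field (ord_rel :: 'a rel) = Field C \<union> Field C1"
    unfolding eq by (auto simp: adjunct_def Field_def)
  then have F: "u \<in> Field C \<or> u \<in> Field C1" for u by auto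
  \<comment> \<open>Distinct atoms are incomparable, so each of the two chains contains at most one
    of \<open>p\<close>, \<open>q\<close>, \<open>x\<close> if these are distinct.\<close>
  have "u \<le> v \<or> v \<le> u \<longleftrightarrow> u = v" if "atom u" "atom v" for u v :: 'a
    using that by (auto simp: atom_iff)
  then show ?thesis
    using lin[OF \<open>fin_chain C\<close> sub(1)] lin[OF C(2) sub(2)] F[of p] F[of q] F[of x] atoms x
    by metis
qed

lemma zero_distributive_imp_atoms:
  assumes "zero_distributive TYPE('a)" and x: "atom (x :: 'a)"
  shows "x = p \<or> x = q"
proof (rule ccontr)
  assume "\<not> (x = p \<or> x = q)"
  then have "inf x p = bot" "inf x q = bot" using atom_inf atoms x by auto
  then have "inf x (sup p q) = bot" using assms(1) by (simp add: zero_distributive_def)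
  then show False using x by (simp add: sup_top atom_iff)
qed

end

section \<open>Two atoms: the lattice as two chains glued at 0 and 1\<close>

locale two_atom_lattice = forked_lattice p q for p q :: "'a::{finite, bounded_lattice}" +
  assumes only_atoms: "\<And>x :: 'a. atom x \<Longrightarrow> x = p \<or> x = q"
begin

text \<open>The assumptions are symmetric in \<open>p\<close> and \<open>q\<close>; interpreting the
  locale with the atoms exchanged transfers results about the side of \<open>p\<close> to the side
  of \<open>q\<close>.\<close>

lemma swap: "two_atom_lattice q p"
  using up_chain atoms sup_top only_atoms
  by unfold_locales (auto simp: sup.commute)

lemma nonzero: "p \<noteq> bot" "q \<noteq> bot"
  using atoms by (auto simp: atom_iff)

lemma cover: "x \<noteq> bot \<Longrightarrow> p \<le> x \<or> q \<le> x"
  by (metis ex_atom_le only_atoms)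

lemma above_both: "p \<le> x \<Longrightarrow> q \<le> x \<Longrightarrow> x = top"
  using sup_top by (metis sup_least top_unique)

lemma not_top: "p \<noteq> top" "q \<noteq> top"
  using atoms nonzero by (auto simp: atom_iff)

text \<open>An element other than 0 and 1 is above exactly one of \<open>p\<close>,
  \<open>q\<close>, and a meet is 0 iff neither atom is below it. The right-hand side thus says that
  \<open>x\<close> and \<open>y\<close> lie on different sides.\<close>

lemma inf_bot_iff:
  assumes "x \<noteq> bot" "y \<noteq> bot" "x \<noteq> top" "y \<noteq> top"
  shows "inf x y = bot \<longleftrightarrow> (p \<le> x \<longleftrightarrow> q \<le> y)"
  using assms cover above_both nonzero by (metis bot_unique inf.bounded_iff)

lemma linear_above: "p \<le> x \<Longrightarrow> p \<le> y \<Longrightarrow> x \<le> y \<or> y \<le> x"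
  using up_chain nonzero by blast

lemma zero_divisors_eq: "zero_divisors = {x :: 'a. x \<noteq> bot \<and> x \<noteq> top}"
proof -
  have "\<exists>y. y \<noteq> bot \<and> inf x y = bot" if x: "x \<noteq> bot" "x \<noteq> top" for x :: 'a
  proof (cases "p \<le> x")
    case True
    then have "inf x q = bot" using inf_bot_iff[of x q] x nonzero not_top by auto
    then show ?thesis using nonzero by blast
  next
    case False
    then have "inf x p = bot" using inf_bot_iff[of x p] x nonzero not_top above_both by auto
    then show ?thesis using nonzero by blast
  qed
  then show ?thesis by (auto simp: zero_divisors_def)
qed

lemma complete_bipartite:
  "complete_bipartite (with_proj (zero_divisor_graph :: 'a pair_pre_digraph))"
proof -
  let ?U = "{x. p \<le> x \<and> x \<noteq> top}" and ?V = "{x. q \<le> x \<and> x \<noteq> top}"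
  have UV: "zero_divisors = ?U \<union> ?V"
    unfolding zero_divisors_eq using cover nonzero by (auto simp: bot_unique)
  have disj: "?U \<inter> ?V = {}" using above_both by blast
  have "(x, y) \<in> parcs zero_divisor_graph \<longleftrightarrow> (x, y) \<in> ?U \<times> ?V \<union> ?V \<times> ?U" for x y
  proof (cases "x \<in> zero_divisors \<and> y \<in> zero_divisors")
    case True
    then have "inf x y = bot \<longleftrightarrow> (p \<le> x \<longleftrightarrow> q \<le> y)" "x \<noteq> bot" "x \<noteq> top" "y \<noteq> bot" "y \<noteq> top"
      using inf_bot_iff[of x y] by (auto simp: zero_divisors_eq)
    then show ?thesis
      using True cover[of x] cover[of y] above_both[of x] above_both[of y]
      by (auto simp: zero_divisor_graph_def)
  next
    case False
    then show ?thesis using UV by (auto simp: zero_divisor_graph_def)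
  qed
  then have E: "parcs (zero_divisor_graph :: 'a pair_pre_digraph) = ?U \<times> ?V \<union> ?V \<times> ?U"
    by (intro set_eqI) (simp only: split_paired_all)
  \<comment> \<open>The definition asks for both sides to be nonempty; each contains its own
    atom.\<close>
  have "p \<in> ?U" "q \<in> ?V" using not_top by auto
  then have "card ?U \<ge> 1" "card ?V \<ge> 1"
    by (metis One_nat_def Suc_leI card_gt_0_iff empty_iff finite)+
  moreover have "complete_bipartite_digraph (card ?U) (card ?V)
      (with_proj (zero_divisor_graph :: 'a pair_pre_digraph))"
  proof -
    have "pverts (zero_divisor_graph :: 'a pair_pre_digraph) = ?U \<union> ?V"
      using UV by (simp add: zero_divisor_graph_def)
    then show ?thesis
      unfolding complete_bipartite_digraph_pair_def using disj E finite by blast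
  qed
  ultimately show ?thesis unfolding complete_bipartite_def by blast
qed

lemma two_chains:
  "\<exists>C0 C1 s. adjunct_of_chains [C0, C1] [s] (ord_rel :: 'a rel)"
proof -
  interpret sw: two_atom_lattice q p by (rule swap)
  \<comment> \<open>Both ends of the adjunct pair \<open>(bot, top)\<close> must belong to the first
    chain, so bottom is added to the up-set of \<open>p\<close> and top is removed from that of
    \<open>q\<close>.\<close>
  let ?S = "insert bot {x. p \<le> x}" and ?T = "{x. q \<le> x \<and> x \<noteq> top}"
  let ?C = "relation_of (\<le>) ?S" and ?D = "relation_of (\<le>) ?T"
  have C: "fin_chain ?C" "Field ?C = ?S"
  proof (rule fin_chain_restrict)
    show "x \<le> y \<or> y \<le> x" if "x \<in> ?S" "y \<in> ?S" for x y
      using that linear_above[of x y] by auto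
  qed (auto simp: relation_of_def Field_def)
  have D: "fin_chain ?D" "Field ?D = ?T"
  proof (rule fin_chain_restrict)
    show "?T \<noteq> {}" using not_top by auto
    show "x \<le> y \<or> y \<le> x" if "x \<in> ?T" "y \<in> ?T" for x y
      using that sw.linear_above[of x y] by auto
  qed (auto simp: relation_of_def Field_def)
  have disj: "?S \<inter> ?T = {}" using above_both nonzero by (auto simp: bot_unique)
  \<comment> \<open>The atom \<open>p\<close> lies strictly between the two ends.\<close>
  have "\<not> covered_by ?C bot top"
    using nonzero not_top by (auto simp: covered_by_def relation_of_def)
  moreover have "(bot :: 'a) \<noteq> top"
    using nonzero by (metis bot_unique top_greatest)
  ultimately have "adjunct_admissible ?C bot top ?D"
    unfolding adjunct_admissible_def C D using disj by (auto simp: relation_of_def)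
  then have "adjunct_of_chains ([?C] @ [?D]) ([] @ [(bot, top)]) (adjunct ?C bot top ?D)"
    using C D by (intro adjunct_of_chains.intros)
  moreover have "adjunct ?C bot top ?D = ord_rel"
  proof (rule adjunct_bot_top_eq)
    show "?S \<union> ?T = UNIV" using cover by auto
    show "x = bot" if "x \<in> ?S" "y \<in> ?T" "x \<le> y" for x y
      using that above_both[of y] order_trans[of p x y] by blast
    show "y = top" if "x \<in> ?T" "y \<in> ?S" "x \<le> y" for x y
    proof -
      have "q \<le> y" using that order_trans[of q x y] by blast
      moreover have "y \<noteq> bot" using \<open>q \<le> y\<close> nonzero(2) bot_unique by blast
      ultimately show ?thesis using that above_both by blast
    qed
  qed (use disj in simp_all)
  ultimately show ?thesis by auto
qed

text \<open>A maximal element among the non-top elements above \<open>p\<close> is a dual atom;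
  uniqueness holds because the elements above \<open>p\<close> form a chain.\<close>

lemma ex1_dual_atom_above: "\<exists>!x. p \<le> x \<and> dual_atom x"
proof -
  have "finite {x. p \<le> x \<and> x \<noteq> top}" "{x. p \<le> x \<and> x \<noteq> top} \<noteq> {}"
    using not_top by auto
  then obtain d where d: "p \<le> d" "d \<noteq> top" and
    m: "\<And>y. p \<le> y \<Longrightarrow> y \<noteq> top \<Longrightarrow> d \<le> y \<Longrightarrow> d = y"
    using finite_has_maximal[of "{x. p \<le> x \<and> x \<noteq> top}"] by auto
  show ?thesis
  proof (rule ex1I)
    show "p \<le> d \<and> dual_atom d"
      using d m by (metis dual_atom_iff order_trans)
  next
    fix x assume "p \<le> x \<and> dual_atom x"
    then show "x = d"
      using linear_above[of x d] d m by (metis dual_atom_iff)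
  qed
qed

lemma card_dual_atoms: "card {x :: 'a. dual_atom x} = 2"
proof -
  interpret sw: two_atom_lattice q p by (rule swap)
  obtain d where d: "p \<le> d" "dual_atom d" "\<And>x. p \<le> x \<Longrightarrow> dual_atom x \<Longrightarrow> x = d"
    using ex1_dual_atom_above by (elim ex1E) blast
  obtain e where e: "q \<le> e" "dual_atom e" "\<And>x. q \<le> x \<Longrightarrow> dual_atom x \<Longrightarrow> x = e"
    using sw.ex1_dual_atom_above by (elim ex1E) blast
  have "d \<noteq> top" using d(2) by (simp add: dual_atom_iff)
  then have "d \<noteq> e" using above_both[of d] d(1) e(1) by blast
  moreover have "x \<noteq> bot" if "dual_atom x" for x :: 'a
    using that nonzero not_top by (auto simp: dual_atom_iff)
  then have "{x :: 'a. dual_atom x} = {d, e}"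
    using cover d e by blast
  ultimately show ?thesis by simp
qed

text \<open>The complement of a principal filter is a down-set with the prime property. It is closed
  under joins here because its nonzero elements all lie above \<open>p\<close> and so form a
  chain.\<close>

lemma minimal_prime: "minimal_prime_lattice_ideal {x. \<not> q \<le> x}"
proof -
  let ?P = "{x. \<not> q \<le> x}"
  have sup: "sup x y \<in> ?P" if "x \<in> ?P" "y \<in> ?P" for x y
  proof (cases "x = bot \<or> y = bot")
    case True
    then show ?thesis using that by auto
  next
    case False
    then have "x \<le> y \<or> y \<le> x" using that cover linear_above by blast
    then show ?thesis using that by (metis sup.absorb1 sup.absorb2)
  qed
  have "bot \<in> ?P" using nonzero by (simp add: bot_unique)
  then have prime: "prime_lattice_ideal ?P"
    using sup unfolding prime_lattice_ideal_def lattice_ideal_def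
    by (auto intro: order_trans)
  \<comment> \<open>For minimality, any \<open>x\<close> not above the atom \<open>q\<close>
    satisfies \<open>inf x q = bot\<close>, which is in \<open>Q\<close>; as \<open>q\<close> is
    outside \<open>Q\<close>, primeness forces \<open>x\<close> into \<open>Q\<close>.\<close>
  have "Q = ?P" if Q: "prime_lattice_ideal Q" "Q \<subseteq> ?P" for Q
  proof
    have "bot \<in> Q"
      using Q unfolding prime_lattice_ideal_def lattice_ideal_def by (metis bot_least ex_in_conv)
    moreover have "inf x q = bot" if "x \<in> ?P" for x
      using that atoms by (metis atom_iff inf.cobounded2 inf.orderI inf_commute mem_Collect_eq)
    moreover have "q \<notin> Q" using Q by auto
    ultimately show "?P \<subseteq> Q"
      using Q unfolding prime_lattice_ideal_def by (metis subsetI)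
  qed (use Q in auto)
  then show ?thesis using prime by (simp add: minimal_prime_lattice_ideal_def)
qed

lemma minimal_primes:
  "\<exists>P1 P2 :: 'a set. P1 \<noteq> P2 \<and> minimal_prime_lattice_ideal P1 \<and>
     minimal_prime_lattice_ideal P2 \<and> P1 \<inter> P2 = {bot}"
proof -
  interpret sw: two_atom_lattice q p by (rule swap)
  have "{x. \<not> q \<le> x} \<inter> {x. \<not> p \<le> x} = {bot}"
    using cover nonzero by (auto simp: bot_unique)
  moreover have "{x. \<not> q \<le> x} \<noteq> {x. \<not> p \<le> x}"
    using above_both not_top by blast
  ultimately show ?thesis using minimal_prime sw.minimal_prime by blast
qed

end

section \<open>Prime ideals, lower dismantlability and the equivalence\<close>

text \<open>A prime ideal either contains \<open>a\<close> or contains both \<open>b\<close> and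
  \<open>c\<close>, hence their join. In both cases it contains \<open>inf a (sup b c)\<close>,
  which therefore lies in the intersection \<open>{bot}\<close>.\<close>

lemma zero_distributive_if_primes:
  fixes P1 P2 :: "'a::bounded_lattice set"
  assumes "prime_lattice_ideal P1" "prime_lattice_ideal P2" "P1 \<inter> P2 = {bot}"
  shows "zero_distributive TYPE('a)"
proof -
  have key: "inf a (sup b c) \<in> P"
    if P: "prime_lattice_ideal P" and bc: "inf a b = bot" "inf a c = bot" and "bot \<in> P"
    for P and a b c :: 'a
  proof (cases "a \<in> P")
    case True
    then show ?thesis using P unfolding prime_lattice_ideal_def lattice_ideal_def by (meson inf.cobounded1)
  next
    case False
    then have "b \<in> P" "c \<in> P" using that unfolding prime_lattice_ideal_def by metis+
    then show ?thesis
      using P unfolding prime_lattice_ideal_def lattice_ideal_def by (meson inf.cobounded2)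
  qed
  have "inf a (sup b c) \<in> P1 \<inter> P2" if "inf a b = bot" "inf a c = bot" for a b c :: 'a
    using key assms that by blast
  then show ?thesis using assms(3) by (auto simp: zero_distributive_def)
qed

lemma lower_dismantlable_forked:
  assumes ld: "lower_dismantlable (ord_rel :: 'a::{finite, bounded_lattice} rel)"
    and ap: "adjunct_pair (ord_rel :: 'a rel) bot top"
  obtains p q :: "'a::{finite, bounded_lattice}" where "forked_lattice p q"
proof -
  obtain Cs ps where A: "adjunct_of_chains Cs ps (ord_rel :: 'a rel)" "(bot, top) \<in> set ps"
    using ap by (auto simp: adjunct_pair_def)
  \<comment> \<open>A chain admits no adjunct pair, so \<open>(bot, top)\<close> rules out the first
    alternative of \<open>lower_dismantlable\<close>, and every pair in \<open>ps\<close> starts at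
    bottom.\<close>
  have "\<not> fin_chain (ord_rel :: 'a rel)"
    using adjunct_of_chains_linear[OF A(1)] A(2) by (auto simp: fin_chain_def)
  then have "a = bot" if "(a, b) \<in> set ps" for a b
    using ld A(1) that unfolding lower_dismantlable_def adjunct_pair_def least_in_def
    by (metis Field_ord_rel UNIV_I bot_unique ord_rel_iff)
  then have ps: "fst ` set ps \<subseteq> {bot}" by auto
  have chain: "y \<le> z \<or> z \<le> y" if "x \<noteq> bot" "x \<le> y" "x \<le> z" for x y z :: 'a
    using adjunct_of_chains_up_chain[OF A(1) _ ps that(1)] that by auto
  obtain x y :: 'a where xy: "x \<noteq> bot" "x \<noteq> top" "y \<noteq> bot" "y \<noteq> top"
    and up: "\<And>z. x \<le> z \<Longrightarrow> y \<le> z \<Longrightarrow> z = top"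
    using adjunct_of_chains_fork[OF A(1) _ ps A(2)] by auto
  have inc: "\<not> x \<le> y" "\<not> y \<le> x" using up xy by auto
  obtain p where p: "atom p" "p \<le> x" using ex_atom_le xy by metis
  obtain q where q: "atom q" "q \<le> y" using ex_atom_le xy by metis
  have nz: "p \<noteq> bot" "q \<noteq> bot" using p q by (auto simp: atom_iff)
  \<comment> \<open>If \<open>p\<close> were below \<open>y\<close>, then \<open>x\<close> and
    \<open>y\<close> would be comparable, both being above \<open>p\<close>; likewise for
    \<open>q\<close> and \<open>x\<close>.\<close>
  have nle: "\<not> p \<le> y" "\<not> q \<le> x" using chain nz p q inc by blast+
  let ?z = "sup p q"
  \<comment> \<open>Both \<open>x\<close> and \<open>sup p q\<close> are above \<open>p\<close>,
    hence comparable, and \<open>sup p q\<close> below \<open>x\<close> would put \<open>q\<close>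
    below \<open>x\<close>.\<close>
  have "x \<le> ?z" using chain[OF nz(1) p(2), of ?z] nle(2) by auto
  moreover have "y \<le> ?z" using chain[OF nz(2) q(2), of ?z] nle(1) by auto
  ultimately have "?z = top" by (rule up)
  moreover have "p \<noteq> q" using nle q by auto
  ultimately have "forked_lattice p q"
    using chain p q by unfold_locales auto
  then show thesis ..
qed

theorem theorem2p16:
  assumes "lower_dismantlable (ord_rel :: 'a::{finite, bounded_lattice} rel)"
    and "adjunct_pair (ord_rel :: 'a rel) bot top"
  shows
    "(complete_bipartite (with_proj (zero_divisor_graph :: 'a pair_pre_digraph)) \<longleftrightarrow>
        (\<exists>C0 C1 p. adjunct_of_chains [C0, C1] [p] (ord_rel :: 'a rel))) \<and>
     ((\<exists>C0 C1 p. adjunct_of_chains [C0, C1] [p] (ord_rel :: 'a rel)) \<longleftrightarrow>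
        card {x :: 'a. atom x} = 2 \<and> card {x :: 'a. dual_atom x} = 2) \<and>
     (card {x :: 'a. atom x} = 2 \<and> card {x :: 'a. dual_atom x} = 2 \<longleftrightarrow>
        (\<exists>P1 P2 :: 'a set. P1 \<noteq> P2 \<and> minimal_prime_lattice_ideal P1 \<and>
           minimal_prime_lattice_ideal P2 \<and> P1 \<inter> P2 = {bot})) \<and>
     ((\<exists>P1 P2 :: 'a set. P1 \<noteq> P2 \<and> minimal_prime_lattice_ideal P1 \<and>
           minimal_prime_lattice_ideal P2 \<and> P1 \<inter> P2 = {bot}) \<longleftrightarrow>
        zero_distributive TYPE('a))"
proof -
  obtain p q :: 'a where "forked_lattice p q"
    using lower_dismantlable_forked assms by blast
  then interpret forked_lattice p q .
  \<comment> \<open>Every statement is reduced to this one condition, that there is no third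
    atom.\<close>
  let ?A = "\<forall>x :: 'a. atom x \<longrightarrow> x = p \<or> x = q"
  have W: "two_atom_lattice p q" if ?A
    using that by unfold_locales blast
  have a: "complete_bipartite (with_proj (zero_divisor_graph :: 'a pair_pre_digraph)) \<longleftrightarrow> ?A"
    using complete_bipartite_imp_atoms two_atom_lattice.complete_bipartite[OF W] by blast
  have b: "(\<exists>C0 C1 s. adjunct_of_chains [C0, C1] [s] (ord_rel :: 'a rel)) \<longleftrightarrow> ?A"
    using two_chains_imp_atoms two_atom_lattice.two_chains[OF W] by blast
  have c: "card {x :: 'a. atom x} = 2 \<and> card {x :: 'a. dual_atom x} = 2 \<longleftrightarrow> ?A"
    using card_atoms_iff two_atom_lattice.card_dual_atoms[OF W] by blast
  let ?D = "\<exists>P1 P2 :: 'a set. P1 \<noteq> P2 \<and> minimal_prime_lattice_ideal P1 \<and>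
    minimal_prime_lattice_ideal P2 \<and> P1 \<inter> P2 = {bot}"
  \<comment> \<open>The last two statements are settled by a cycle: prime ideals give
    0-distributivity, which gives \<open>?A\<close>, which gives the prime ideals.\<close>
  have "?D \<Longrightarrow> zero_distributive TYPE('a)"
    using zero_distributive_if_primes unfolding minimal_prime_lattice_ideal_def by blast
  moreover have "zero_distributive TYPE('a) \<Longrightarrow> ?A"
    using zero_distributive_imp_atoms by blast
  moreover have "?A \<Longrightarrow> ?D"
    using two_atom_lattice.minimal_primes[OF W] by blast
  ultimately have d: "?D \<longleftrightarrow> ?A" and e: "zero_distributive TYPE('a) \<longleftrightarrow> ?A"
    by blast+
  show ?thesis
    unfolding a b c d e by simp
qed

end
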